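(* Let $f:\mathbb{R}\to\mathbb{R}$ be a $\mathcal{C}^\infty$ function all of whose derivatives grow at most polynomially at infinity, and suppose $f''>0$ on $\mathbb{R}$. Let $\mu\in(0,1]$ and let $p_1<p_2$ be finite real numbers. Let $u_0$ be a tempered distribution on $\mathbb{R}$ whose Fourier transform $\mathcal{F}u_0$ is a function with $\operatorname{supp}\mathcal{F}u_0=[p_1,p_2]$ and $$\mathcal{F}u_0(p)=(p-p_1)^{\mu-1}\,\tilde u(p)\qquad\text{for all }p\in(p_1,p_2],$$ where $\tilde u:[p_1,p_2]\to\mathbb{C}$ is continuous on $[p_1,p_2]$, differentiable on $(p_1,p_2)$ with $\tilde u'\in L^1(p_1,p_2)$, and $\tilde u(p_1)\neq0$ if $\mu\neq1$. Let $u$ be the solution of $[i\partial_t-f(D)]u=0$, $u(0,\cdot)=u_0$, given by $$u(t,x)=\frac{1}{2\pi}\int_{\mathbb{R}}\mathcal{F}u_0(p)\,e^{-itf(p)+ixp}\,dp ,\qquad t>0,\ x\in\mathbb{R}.$$ Let $\tilde p_1,\tilde p_2$ be finite real numbers with $\tilde p_1<p_1<p_2<\tilde p_2$. Then $$\forall\,t>0\qquad \|u(t,\cdot)\|_{L^\infty(\mathbb{R})}\leqslant c(u_0,f)\,t^{-\frac\mu2}+c^c_{\tilde I}(u_0,f)\,t^{-\mu},$$ and in particular $$\forall\,t\geqslant1\qquad \|u(t,\cdot)\|_{L^\infty(\mathbb{R})}\leqslant \big(c(u_0,f)+c^c_{\tilde I}(u_0,f)\big)\,t^{-\frac\mu2},$$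 where, with $m:=\min_{p\in[p_1,p_2]}f''(p)>0$, $m_{\tilde p_1}:=f'(p_1)-f'(\tilde p_1)>0$ and $m_{\tilde p_2}:=f'(\tilde p_2)-f'(p_2)>0$, $$c(u_0,f):=\frac{1}{2\pi}\,\frac{3}{\mu}\,\|\tilde u\|_{L^\infty(p_1,p_2)}+\frac1\pi\Big(4\|\tilde u\|_{L^\infty(p_1,p_2)}+\|\tilde u'\|_{L^1(p_1,p_2)}\Big)m^{-1},$$ $$c^c_{\tilde I}(u_0,f):=\sum_{j=1}^{2}\left[\frac{1}{2\pi}\,\frac1\mu\,\|\tilde u\|_{L^\infty(p_1,p_2)}+\frac{1}{2\pi}\Big(4\|\tilde u\|_{L^\infty(p_1,p_2)}+\|\tilde u'\|_{L^1(p_1,p_2)}\Big)m_{\tilde p_j}^{-1}\right].$$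
   Context: Fourier transform convention: $\mathcal{F}v(p)=\int_{\mathbb{R}}v(x)e^{-ixp}\,dx$, extended to tempered distributions. $f(D)$ is the Fourier multiplier $f(D)v=\mathcal{F}^{-1}(f\,\mathcal{F}v)$. Under the hypotheses $\mathcal{F}u_0$ is integrable, so the formula for $u$ is well defined for all $t>0$, $x\in\mathbb{R}$. Notation: $\tilde I:=[\tilde p_1,\tilde p_2]$. *)

theory Defs
  imports
    "HOL-Analysis.Analysis"
    "HOL-Library.Landau_Symbols"
    "HOL-Probability.Essential_Supremum"
begin

section \<open>Smooth symbols\<close>

definition smooth_real :: "(real \<Rightarrow> real) \<Rightarrow> bool" where
  "smooth_real f \<longleftrightarrow> (\<forall>n x. (deriv ^^ n) f field_differentiable at x)"

text \<open>For \<open>n \<ge> 1\<close> only: polynomial growth of \<open>f\<close> itself then follows by integration.\<close>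

definition polynomially_growing_derivs :: "(real \<Rightarrow> real) \<Rightarrow> bool" where
  "polynomially_growing_derivs f \<longleftrightarrow>
     (\<forall>n\<ge>1. \<exists>N. (deriv ^^ n) f \<in> O[at_infinity](\<lambda>x. x ^ N))"

section \<open>Tempered distributions and their Fourier transform\<close>

definition vderiv :: "(real \<Rightarrow> complex) \<Rightarrow> real \<Rightarrow> complex" where
  "vderiv \<phi> = (\<lambda>x. vector_derivative \<phi> (at x))"

definition schwartz :: "(real \<Rightarrow> complex) set" where
  "schwartz = {\<phi>. (\<forall>n x. (vderiv ^^ n) \<phi> differentiable at x) \<and>
                  (\<forall>k n. bounded (range (\<lambda>x. x ^ k *\<^sub>R (vderiv ^^ n) \<phi> x)))}"

definition schwartz_seminorm :: "nat \<Rightarrow> nat \<Rightarrow> (real \<Rightarrow> complex) \<Rightarrow> real" where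
  "schwartz_seminorm k n \<phi> = (SUP x. norm (x ^ k *\<^sub>R (vderiv ^^ n) \<phi> x))"

definition schwartz_tendsto :: "(nat \<Rightarrow> real \<Rightarrow> complex) \<Rightarrow> (real \<Rightarrow> complex) \<Rightarrow> bool" where
  "schwartz_tendsto \<Phi> \<phi> \<longleftrightarrow>
     (\<forall>k n. (\<lambda>j. schwartz_seminorm k n (\<lambda>x. \<Phi> j x - \<phi> x)) \<longlonglongrightarrow> 0)"

text \<open>
  A distribution is a functional on all functions of type \<open>real \<Rightarrow> complex\<close>, of which only the
  values on Schwartz functions are meaningful. The Schwartz space being metrizable, sequential
  continuity is continuity.
\<close>

definition tempered_distribution :: "((real \<Rightarrow> complex) \<Rightarrow> complex) \<Rightarrow> bool" where
  "tempered_distribution T \<longleftrightarrow>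
     (\<forall>\<phi>\<in>schwartz. \<forall>\<psi>\<in>schwartz. \<forall>a b. T (\<lambda>x. a * \<phi> x + b * \<psi> x) = a * T \<phi> + b * T \<psi>) \<and>
     (\<forall>\<Phi>. \<forall>\<phi>\<in>schwartz. (\<forall>j. \<Phi> j \<in> schwartz) \<longrightarrow> schwartz_tendsto \<Phi> \<phi> \<longrightarrow>
        (\<lambda>j. T (\<Phi> j)) \<longlonglongrightarrow> T \<phi>)"

definition fourier :: "(real \<Rightarrow> complex) \<Rightarrow> real \<Rightarrow> complex" where
  "fourier v p = (LINT x|lborel. v x * exp (- \<i> * complex_of_real (x * p)))"

definition fourier_distr :: "((real \<Rightarrow> complex) \<Rightarrow> complex) \<Rightarrow> (real \<Rightarrow> complex) \<Rightarrow> complex" where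
  "fourier_distr T \<phi> = T (fourier \<phi>)"

definition test_functions :: "(real \<Rightarrow> complex) set" where
  "test_functions = {\<phi> \<in> schwartz. bounded {x. \<phi> x \<noteq> 0}}"

text \<open>The distribution \<open>T\<close> is (integration against) the locally integrable function \<open>g\<close>.\<close>

definition distr_is_function :: "((real \<Rightarrow> complex) \<Rightarrow> complex) \<Rightarrow> (real \<Rightarrow> complex) \<Rightarrow> bool" where
  "distr_is_function T g \<longleftrightarrow>
     (\<forall>a b. set_integrable lborel {a..b} g) \<and>
     (\<forall>\<phi>\<in>test_functions. T \<phi> = (LINT x|lborel. g x * \<phi> x))"

text \<open>
  The support of a function given up to null sets: the complement of the largest open set on
  which it vanishes almost everywhere. It is the support of the distribution defined by \<open>g\<close>.
\<close>

definition ess_support :: "(real \<Rightarrow> complex) \<Rightarrow> real set" where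
  "ess_support g = {x. \<forall>U. open U \<longrightarrow> x \<in> U \<longrightarrow> \<not> (AE y in lborel. y \<in> U \<longrightarrow> g y = 0)}"

section \<open>Norms\<close>

text \<open>Infinite for unbounded and for non-measurable functions.\<close>

definition Linf_norm :: "real set \<Rightarrow> (real \<Rightarrow> complex) \<Rightarrow> ereal" where
  "Linf_norm A v = esssup (restrict_space lborel A) (\<lambda>x. ereal (norm (v x)))"

definition L1_norm :: "real set \<Rightarrow> (real \<Rightarrow> complex) \<Rightarrow> real" where
  "L1_norm A v = (LINT x:A|lborel. norm (v x))"

section \<open>The solution and the constants\<close>

text \<open>The argument \<open>g\<close> is the Fourier transform of the initial datum.\<close>

definition solution :: "(real \<Rightarrow> real) \<Rightarrow> (real \<Rightarrow> complex) \<Rightarrow> real \<Rightarrow> real \<Rightarrow> complex" where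
  "solution f g t x =
     1 / (2 * pi) *
       (LINT p|lborel. g p * exp (- \<i> * complex_of_real (t * f p) + \<i> * complex_of_real (x * p)))"

text \<open>\<open>LEAST\<close> is the minimum of the set (not merely its infimum); it exists here by compactness.\<close>

definition min_second_deriv :: "(real \<Rightarrow> real) \<Rightarrow> real \<Rightarrow> real \<Rightarrow> real" where
  "min_second_deriv f p1 p2 = (LEAST m. m \<in> deriv (deriv f) ` {p1..p2})"

definition const_c :: "(real \<Rightarrow> real) \<Rightarrow> real \<Rightarrow> (real \<Rightarrow> complex) \<Rightarrow> real \<Rightarrow> real \<Rightarrow> real" where
  "const_c f \<mu> w p1 p2 =
    (let I = {p1<..<p2};
         sup_w = real_of_ereal (Linf_norm I w);
         int_w' = L1_norm I (vderiv w);
         m = min_second_deriv f p1 p2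
     in 1 / (2 * pi) * (3 / \<mu>) * sup_w + 1 / pi * (4 * sup_w + int_w') * inverse m)"

definition const_cc :: "(real \<Rightarrow> real) \<Rightarrow> real \<Rightarrow> (real \<Rightarrow> complex) \<Rightarrow> real \<Rightarrow> real
    \<Rightarrow> real \<Rightarrow> real \<Rightarrow> real" where
  "const_cc f \<mu> w p1 p2 q1 q2 =
    (let I = {p1<..<p2};
         sup_w = real_of_ereal (Linf_norm I w);
         int_w' = L1_norm I (vderiv w);
         m1 = deriv f p1 - deriv f q1;
         m2 = deriv f q2 - deriv f p2
     in \<Sum>m\<leftarrow>[m1, m2].
          1 / (2 * pi) * (1 / \<mu>) * sup_w + 1 / (2 * pi) * (4 * sup_w + int_w') * inverse m)"

end

theory Submission
  imports Defs
begin

text \<open>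
  On \<open>[p1, p2]\<close> the derivative of the phase \<open>t f(p) - x p\<close> increases at rate at least \<open>t m\<close>. Hence for
  every \<open>x\<close>, stationary point in the interval or not, there is a point \<open>p0\<close> of \<open>[p1, p2]\<close> with
  \<open>\<bar>t f'(p) - x\<bar> \<ge> t m \<bar>p - p0\<bar>\<close> throughout, namely the stationary point clamped to \<open>[p1, p2]\<close>.
  With \<open>\<delta> = t powr (-1/2)\<close>, the integral over the points within \<open>\<delta>\<close> of \<open>p1\<close> or \<open>p0\<close> is estimated by
  absolute values, and on each of the at most two remaining intervals one integration by parts is
  used. This bounds \<open>u\<close> by the \<open>t powr (- \<mu> / 2)\<close> term alone, uniformly in \<open>x\<close>; the term with
  \<open>t powr (- \<mu>)\<close> is nonnegative.
\<close>

section \<open>Oscillatory integrals without stationary points\<close>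

lemma has_vector_derivative_exp_phase:
  assumes "(h has_real_derivative h1) (at p)"
  shows "((\<lambda>p. exp (- \<i> * complex_of_real (h p))) has_vector_derivative
           - \<i> * complex_of_real h1 * exp (- \<i> * complex_of_real (h p))) (at p)"
proof -
  have "((\<lambda>p. complex_of_real (h p)) has_vector_derivative complex_of_real h1) (at p)"
    using has_vector_derivative_of_real assms by blast
  then have "((\<lambda>p. - \<i> * complex_of_real (h p)) has_vector_derivative - \<i> * complex_of_real h1) (at p)"
    by (rule has_vector_derivative_mult_right)
  from field_vector_diff_chain_at[OF this DERIV_exp]
  show ?thesis by (simp add: o_def)
qed

text \<open>Integration by parts, as \<open>\<i> * exp (- \<i> * h)\<close> has derivative
  \<open>h1 * exp (- \<i> * h)\<close>. The boundary terms cost \<open>2 * M / \<kappa>\<close> and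
  the derivative of \<open>A\<close> costs \<open>V / \<kappa>\<close>. Since \<open>h2\<close> is
  nonnegative, \<open>inverse h1\<close> is nonincreasing, so the integral of its derivative
  telescopes and costs \<open>M / \<kappa>\<close>, however large \<open>h2\<close> is. The majorant
  \<open>D\<close> allows \<open>V\<close> to be computed from an explicit antiderivative.\<close>

lemma van_der_corput_amplitude:
  fixes h h1 h2 D :: "real \<Rightarrow> real" and A A' :: "real \<Rightarrow> complex"
  assumes "a \<le> b"
    and h: "\<And>p. p \<in> {a..b} \<Longrightarrow> (h has_real_derivative h1 p) (at p)"
    and h1: "\<And>p. p \<in> {a..b} \<Longrightarrow> (h1 has_real_derivative h2 p) (at p)"
    and convex: "\<And>p. p \<in> {a..b} \<Longrightarrow> 0 \<le> h2 p"
    and "0 < \<kappa>"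
    and h1_large: "(\<forall>p\<in>{a..b}. \<kappa> \<le> h1 p) \<or> (\<forall>p\<in>{a..b}. h1 p \<le> - \<kappa>)"
    and A: "continuous_on {a..b} A"
    and A': "\<And>p. p \<in> {a<..<b} \<Longrightarrow> (A has_vector_derivative A' p) (at p)"
    and A_le: "\<And>p. p \<in> {a..b} \<Longrightarrow> norm (A p) \<le> M"
    and A'_le: "\<And>p. p \<in> {a<..<b} \<Longrightarrow> norm (A' p) \<le> D p"
    and D: "(D has_integral V) {a..b}"
  shows "norm (integral {a..b} (\<lambda>p. A p * exp (- \<i> * complex_of_real (h p)))) \<le> (3 * M + V) / \<kappa>"
proof -
  define e where "e = (\<lambda>p. exp (- \<i> * complex_of_real (h p)))"
  \<comment> \<open>\<open>G\<close> is chosen so that its derivative is \<open>A * e + R\<close>,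
    where \<open>R\<close> collects the terms in which the derivative falls on \<open>A\<close> or
    on \<open>inverse h1\<close>.\<close>
  define G where "G = (\<lambda>p. complex_of_real (inverse (h1 p)) * (A p * (\<i> * e p)))"
  define R where "R = (\<lambda>p. (complex_of_real (inverse (h1 p)) * A' p
      - complex_of_real (h2 p * inverse (h1 p) ^ 2) * A p) * (\<i> * e p))"
  have M0: "0 \<le> M" using A_le[of a] \<open>a \<le> b\<close> by (force intro: order_trans[OF norm_ge_zero])
  have h1_abs: "\<kappa> \<le> \<bar>h1 p\<bar>" if "p \<in> {a..b}" for p
    using h1_large that by force
  have h1_nz: "h1 p \<noteq> 0" if "p \<in> {a..b}" for p
    using h1_abs[OF that] \<open>0 < \<kappa>\<close> by auto
  have inv_le: "\<bar>inverse (h1 p)\<bar> \<le> 1 / \<kappa>" if "p \<in> {a..b}" for p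
    using h1_abs[OF that] \<open>0 < \<kappa>\<close> by (simp add: divide_simps abs_inverse)
  have norm_e: "norm (e p) = 1" for p
    unfolding e_def by (simp add: norm_exp_eq_Re)
  have inv_deriv: "((\<lambda>p. inverse (h1 p)) has_real_derivative - (h2 p * inverse (h1 p) ^ 2)) (at p)"
    if "p \<in> {a..b}" for p
    using DERIV_inverse_fun[OF h1[OF that] h1_nz[OF that]]
    by (simp add: power2_eq_square algebra_simps)
  have e_deriv: "(e has_vector_derivative - \<i> * complex_of_real (h1 p) * e p) (at p)"
    if "p \<in> {a..b}" for p
    unfolding e_def by (rule has_vector_derivative_exp_phase[OF h[OF that]])
  have cont_e: "continuous_on {a..b} e"
    by (intro continuous_at_imp_continuous_on ballI) (rule has_vector_derivative_continuous[OF e_deriv])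
  have cont_inv: "continuous_on {a..b} (\<lambda>p. inverse (h1 p))"
    by (intro continuous_at_imp_continuous_on ballI) (rule DERIV_isCont[OF inv_deriv])
  have cont_G: "continuous_on {a..b} G"
    unfolding G_def by (intro continuous_on_mult continuous_on_of_real cont_inv A cont_e continuous_on_const)
  have Ae: "(\<lambda>p. A p * e p) integrable_on {a..b}"
    by (intro integrable_continuous_real continuous_intros A cont_e)
  have G_deriv: "(G has_vector_derivative A p * e p + R p) (at p)" if "p \<in> {a<..<b}" for p
  proof -
    have p: "p \<in> {a..b}" using that by auto
    have 1: "((\<lambda>p. complex_of_real (inverse (h1 p))) has_vector_derivative
              complex_of_real (- (h2 p * inverse (h1 p) ^ 2))) (at p)"
      using has_vector_derivative_of_real inv_deriv[OF p] by blast
    have "(G has_vector_derivative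
        complex_of_real (inverse (h1 p)) * (A p * (\<i> * (- \<i> * complex_of_real (h1 p) * e p)) + A' p * (\<i> * e p))
        + complex_of_real (- (h2 p * inverse (h1 p) ^ 2)) * (A p * (\<i> * e p))) (at p)"
      unfolding G_def
      by (intro has_vector_derivative_mult 1 A'[OF that] has_vector_derivative_mult_right e_deriv[OF p])
    \<comment> \<open>With \<open>c\<close> for \<open>inverse (h1 p)\<close> and \<open>d\<close>
      for \<open>h1 p\<close>, the outcome of the product rule is a polynomial identity modulo
      \<open>c * d = 1\<close> and the square of \<open>\<i>\<close> being -1.\<close>
    moreover have "c * (A p * (\<i> * (- \<i> * d * e p)) + A' p * (\<i> * e p)) + - (k * c ^ 2) * (A p * (\<i> * e p))
        = A p * e p + (c * A' p - k * c ^ 2 * A p) * (\<i> * e p)" if "c * d = 1" for c d k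
      using that i_squared by algebra
    from this[of "complex_of_real (inverse (h1 p))" "complex_of_real (h1 p)" "complex_of_real (h2 p)"]
    have "complex_of_real (inverse (h1 p)) * (A p * (\<i> * (- \<i> * complex_of_real (h1 p) * e p)) + A' p * (\<i> * e p))
        + complex_of_real (- (h2 p * inverse (h1 p) ^ 2)) * (A p * (\<i> * e p)) = A p * e p + R p"
      unfolding R_def using h1_nz[OF p] by simp
    ultimately show ?thesis by simp
  qed
  have "((\<lambda>p. A p * e p + R p) has_integral (G b - G a)) {a..b}"
    by (rule fundamental_theorem_of_calculus_interior[OF \<open>a \<le> b\<close> cont_G G_deriv])
  from has_integral_diff[OF this integrable_integral[OF Ae]]
  have R_int: "(R has_integral (G b - G a - integral {a..b} (\<lambda>p. A p * e p))) {a..b}"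
    by simp
  \<comment> \<open>A majorant of \<open>norm R\<close>. Its second summand is \<open>- M\<close>
    times the derivative of \<open>inverse h1\<close>, so its integral is a difference of endpoint
    values.\<close>
  define B where "B = (\<lambda>p. D p / \<kappa> + M * (h2 p * inverse (h1 p) ^ 2))"
  have "((\<lambda>p. - (h2 p * inverse (h1 p) ^ 2)) has_integral (inverse (h1 b) - inverse (h1 a))) {a..b}"
    by (rule fundamental_theorem_of_calculus[OF \<open>a \<le> b\<close>])
       (simp add: has_field_derivative_at_within[OF inv_deriv] flip: has_real_derivative_iff_has_vector_derivative)
  from has_integral_neg[OF this]
  have B_int: "(B has_integral (V / \<kappa> + M * (inverse (h1 a) - inverse (h1 b)))) {a..b}"
    unfolding B_def
    by (intro has_integral_add has_integral_mult_right has_integral_divide D) simp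
  have R_le: "norm (R p) \<le> B p" if "p \<in> {a<..<b}" for p
  proof -
    have p: "p \<in> {a..b}" using that by auto
    have "norm (R p) \<le> \<bar>inverse (h1 p)\<bar> * norm (A' p) + (h2 p * inverse (h1 p) ^ 2) * norm (A p)"
      unfolding R_def norm_mult norm_e using convex[OF p]
      by (intro order_trans[OF mult_right_mono[OF norm_triangle_ineq4]])
         (auto simp: norm_mult norm_power norm_inverse norm_e power_inverse)
    also have "\<dots> \<le> (1 / \<kappa>) * D p + (h2 p * inverse (h1 p) ^ 2) * M"
      using convex[OF p] inv_le[OF p] A_le[OF p] A'_le[OF that] \<open>0 < \<kappa>\<close>
      by (intro add_mono mult_mono) auto
    finally show ?thesis unfolding B_def by (simp add: algebra_simps)
  qed
  have "norm (G b - G a - integral {a..b} (\<lambda>p. A p * e p)) \<le> V / \<kappa> + M * (inverse (h1 a) - inverse (h1 b))"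
  proof -
    \<comment> \<open>The comparison runs over the open interval because \<open>A'\<close> is
      controlled only there; the endpoints do not affect the integrals.\<close>
    have "norm (integral {a<..<b} R) \<le> integral {a<..<b} B"
      using R_int B_int unfolding has_integral_Icc_iff_Ioo
      by (intro integral_norm_bound_integral R_le) (auto intro: has_integral_integrable)
    then show ?thesis
      using integral_unique[OF R_int[unfolded has_integral_Icc_iff_Ioo]]
        integral_unique[OF B_int[unfolded has_integral_Icc_iff_Ioo]] by simp
  qed
  moreover have "norm (G p) \<le> M * \<bar>inverse (h1 p)\<bar>" if "p \<in> {a..b}" for p
    unfolding G_def using A_le[OF that]
    by (simp add: norm_mult norm_e norm_inverse mult.commute mult_right_mono)
  then have "norm (G b) \<le> M * \<bar>inverse (h1 b)\<bar>" "norm (G a) \<le> M * \<bar>inverse (h1 a)\<bar>"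
    using \<open>a \<le> b\<close> by auto
  ultimately have "norm (integral {a..b} (\<lambda>p. A p * e p))
      \<le> V / \<kappa> + M * (\<bar>inverse (h1 a)\<bar> + \<bar>inverse (h1 b)\<bar> + (inverse (h1 a) - inverse (h1 b)))"
    using norm_triangle_ineq4[of "G b - G a" "G b - G a - integral {a..b} (\<lambda>p. A p * e p)"]
      norm_triangle_ineq4[of "G b" "G a"] by (simp add: distrib_left)
  also have "\<dots> \<le> V / \<kappa> + M * (3 / \<kappa>)"
  proof -
    \<comment> \<open>Both inverses have the same sign and modulus at most
      \<open>1 / \<kappa>\<close>, so their difference is at most \<open>1 / \<kappa>\<close> as
      well.\<close>
    have "\<bar>inverse (h1 a)\<bar> + \<bar>inverse (h1 b)\<bar> + (inverse (h1 a) - inverse (h1 b)) \<le> 3 * (1 / \<kappa>)"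
    proof -
      have "(0 < inverse (h1 a) \<and> 0 < inverse (h1 b)) \<or> (inverse (h1 a) < 0 \<and> inverse (h1 b) < 0)"
        using h1_large \<open>a \<le> b\<close> \<open>0 < \<kappa>\<close> by force
      moreover have "\<bar>inverse (h1 a)\<bar> \<le> 1 / \<kappa>" "\<bar>inverse (h1 b)\<bar> \<le> 1 / \<kappa>" "0 < 1 / \<kappa>"
        using inv_le \<open>a \<le> b\<close> \<open>0 < \<kappa>\<close> by auto
      ultimately show ?thesis by linarith
    qed
    then show ?thesis by (intro add_left_mono mult_left_mono M0) simp
  qed
  finally show ?thesis unfolding e_def by (simp add: add_divide_distrib mult.commute)
qed

section \<open>Oscillatory integrals with a singular amplitude and a possible stationary
  point\<close>

text \<open>The windows near \<open>p1\<close> and \<open>p0\<close> have total length at most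
  \<open>3 * \<delta>\<close> and account for the first term. On each of the at most two other
  intervals the amplitude is at most \<open>S * \<delta> powr (\<mu> - 1)\<close> and
  \<open>h1\<close> is at least \<open>\<kappa> * \<delta>\<close> in modulus, whence the power
  \<open>\<mu> - 2\<close>. The parameter \<open>\<delta>\<close> stays free, to be balanced against
  \<open>\<kappa>\<close> later. Integrability of \<open>F\<close> is a hypothesis because the
  amplitude may be unbounded near \<open>p1\<close>; it will come from the integrability of the
  Fourier transform.\<close>

lemma singular_oscillatory_integral_bound:
  fixes p1 p2 \<mu> \<kappa> \<delta> S W :: real and h h1 h2 :: "real \<Rightarrow> real" and w w' :: "real \<Rightarrow> complex"
  defines "F \<equiv> \<lambda>p. complex_of_real ((p - p1) powr (\<mu> - 1)) * w p * exp (- \<i> * complex_of_real (h p))"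
  assumes "p1 < p2" "0 < \<mu>" "\<mu> \<le> 1" "0 < \<kappa>" "0 < \<delta>"
    and h: "\<And>p. p \<in> {p1..p2} \<Longrightarrow> (h has_real_derivative h1 p) (at p)"
    and h1: "\<And>p. p \<in> {p1..p2} \<Longrightarrow> (h1 has_real_derivative h2 p) (at p)"
    and h2: "\<And>p. p \<in> {p1..p2} \<Longrightarrow> \<kappa> \<le> h2 p"
    and w: "continuous_on {p1..p2} w"
    and w': "\<And>p. p \<in> {p1<..<p2} \<Longrightarrow> (w has_vector_derivative w' p) (at p)"
    and w_le: "\<And>p. p \<in> {p1..p2} \<Longrightarrow> norm (w p) \<le> S"
    and W: "((\<lambda>p. norm (w' p)) has_integral W) {p1..p2}"
    and F_int: "F integrable_on {p1..p2}"
  shows "norm (integral {p1..p2} F) \<le> 3 / \<mu> * S * \<delta> powr \<mu> + 2 * ((4 * S + W) / \<kappa> * \<delta> powr (\<mu> - 2))"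
proof -
  have S0: "0 \<le> S" using w_le[of p1] \<open>p1 < p2\<close> by (force intro: order_trans[OF norm_ge_zero])
  have W0: "0 \<le> W" using W by (rule has_integral_nonneg) auto
  define K where "K = (4 * S + W) / \<kappa> * \<delta> powr (\<mu> - 2)"
  have K0: "0 \<le> K" unfolding K_def using S0 W0 \<open>0 < \<kappa>\<close> by simp
  have F_sub: "F integrable_on {a..b}" if "p1 \<le> a" "b \<le> p2" for a b
    using integrable_subinterval_real[OF F_int] that by auto
  have norm_F: "norm (F p) = (p - p1) powr (\<mu> - 1) * norm (w p)" for p
    unfolding F_def by (simp add: norm_mult norm_exp_eq_Re)
  have amp_le: "(p - p1) powr (\<mu> - 1) \<le> \<delta> powr (\<mu> - 1)" if "p1 + \<delta> \<le> p" for p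
    using that \<open>0 < \<delta>\<close> \<open>\<mu> \<le> 1\<close> by (intro powr_mono2') auto

  have singular: "norm (integral {p1..c} F) \<le> S * ((c - p1) powr \<mu> / \<mu>)" if c: "p1 \<le> c" "c \<le> p2" for c
  proof -
    have "((\<lambda>p. (p - p1) powr (\<mu> - 1)) has_integral ((c - p1) powr \<mu> / \<mu> - (p1 - p1) powr \<mu> / \<mu>)) {p1..c}"
    \<comment> \<open>For \<mu> < 1 the integrand blows up at \<open>p1\<close>, but its
      antiderivative is continuous there because \<mu> > 0; differentiability in the interior
      suffices.\<close>
    proof (rule fundamental_theorem_of_calculus_interior[OF c(1)])
      show "continuous_on {p1..c} (\<lambda>p. (p - p1) powr \<mu> / \<mu>)"
        using \<open>0 < \<mu>\<close> by (intro continuous_intros continuous_on_powr') auto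
      show "((\<lambda>p. (p - p1) powr \<mu> / \<mu>) has_vector_derivative (p - p1) powr (\<mu> - 1)) (at p)"
        if "p \<in> {p1<..<c}" for p
        unfolding has_real_derivative_iff_has_vector_derivative[symmetric]
        using that \<open>0 < \<mu>\<close> by (auto intro!: derivative_eq_intros)
    qed
    from has_integral_mult_right[OF this, of S]
    have I: "((\<lambda>p. S * (p - p1) powr (\<mu> - 1)) has_integral S * ((c - p1) powr \<mu> / \<mu>)) {p1..c}"
      by simp
    have "norm (integral {p1..c} F) \<le> integral {p1..c} (\<lambda>p. S * (p - p1) powr (\<mu> - 1))"
    proof (rule integral_norm_bound_integral)
      show "norm (F p) \<le> S * (p - p1) powr (\<mu> - 1)" if "p \<in> {p1..c}" for p
        unfolding norm_F using w_le[of p] that c by (simp add: mult.commute mult_right_mono)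
    qed (use I F_sub c in auto)
    then show ?thesis using I by (simp add: has_integral_iff)
  qed

  have regular: "norm (integral {a..b} F) \<le> \<delta> powr (\<mu> - 1) * S * (b - a)"
    if ab: "p1 + \<delta> \<le> a" "a \<le> b" "b \<le> p2" for a b
  proof -
    have "norm (integral {a..b} F) \<le> integral {a..b} (\<lambda>p. \<delta> powr (\<mu> - 1) * S)"
    proof (rule integral_norm_bound_integral)
      show "norm (F p) \<le> \<delta> powr (\<mu> - 1) * S" if "p \<in> {a..b}" for p
        unfolding norm_F using w_le[of p] amp_le[of p] that ab \<open>0 < \<delta>\<close> by (intro mult_mono) auto
    qed (use F_sub ab \<open>0 < \<delta>\<close> in auto)
    then show ?thesis using ab by (simp add: mult_ac)
  qed

  have nonstationary: "norm (integral {a..b} F) \<le> K"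
    if ab: "p1 + \<delta> \<le> a" "b \<le> p2"
      and large: "(\<forall>p\<in>{a..b}. \<kappa> * \<delta> \<le> h1 p) \<or> (\<forall>p\<in>{a..b}. h1 p \<le> - (\<kappa> * \<delta>))" for a b
  proof (cases "a \<le> b")
    case False
    then show ?thesis using K0 by simp
  next
    case True
    have sub: "{a..b} \<subseteq> {p1..p2}" "{a..b} \<subseteq> {p1<..p2}" "{a<..<b} \<subseteq> {p1<..<p2}"
      using ab \<open>0 < \<delta>\<close> by auto
    \<comment> \<open>The derivative of the singular factor. It is nonpositive because \<mu> is at
      most 1, so the total variation of the factor is the difference of its endpoint values, at most
      \<open>\<delta> powr (\<mu> - 1)\<close>.\<close>
    define \<beta>' where "\<beta>' = (\<lambda>p. (\<mu> - 1) * (p - p1) powr (\<mu> - 1 - 1))"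
    have \<beta>: "((\<lambda>p. (p - p1) powr (\<mu> - 1)) has_real_derivative \<beta>' p) (at p)" if "p1 < p" for p
      unfolding \<beta>'_def using that by (auto intro!: derivative_eq_intros)
    have "(\<beta>' has_integral ((b - p1) powr (\<mu> - 1) - (a - p1) powr (\<mu> - 1))) {a..b}"
    proof (rule fundamental_theorem_of_calculus[OF True])
      show "((\<lambda>p. (p - p1) powr (\<mu> - 1)) has_vector_derivative \<beta>' p) (at p within {a..b})"
        if "p \<in> {a..b}" for p
        unfolding has_real_derivative_iff_has_vector_derivative[symmetric]
        using \<beta>[of p] that sub(2) by (auto simp: has_field_derivative_at_within)
    qed
    from has_integral_neg[OF this]
    have \<beta>_int: "((\<lambda>p. - \<beta>' p) has_integral ((a - p1) powr (\<mu> - 1) - (b - p1) powr (\<mu> - 1))) {a..b}"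
      by simp
    define V where "V = integral {a..b} (\<lambda>p. norm (w' p))"
    have w'_int: "(\<lambda>p. norm (w' p)) integrable_on {a..b}"
      using integrable_subinterval_real[OF has_integral_integrable[OF W] sub(1)] .
    have V: "V \<le> W"
      unfolding V_def using W sub(1) w'_int integral_subset_le[of "{a..b}" "{p1..p2}" "\<lambda>p. norm (w' p)"]
      by (auto simp: has_integral_iff)
    have D: "((\<lambda>p. - \<beta>' p * S + \<delta> powr (\<mu> - 1) * norm (w' p)) has_integral
        (((a - p1) powr (\<mu> - 1) - (b - p1) powr (\<mu> - 1)) * S + \<delta> powr (\<mu> - 1) * V)) {a..b}"
      using \<beta>_int w'_int unfolding V_def
      by (intro has_integral_add has_integral_mult_left has_integral_mult_right) auto
    have "norm (integral {a..b} (\<lambda>p. (complex_of_real ((p - p1) powr (\<mu> - 1)) * w p)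
          * exp (- \<i> * complex_of_real (h p))))
        \<le> (3 * (\<delta> powr (\<mu> - 1) * S)
          + (((a - p1) powr (\<mu> - 1) - (b - p1) powr (\<mu> - 1)) * S + \<delta> powr (\<mu> - 1) * V)) / (\<kappa> * \<delta>)"
    proof (rule van_der_corput_amplitude[OF True _ _ _ _ large _ _ _ _ D])
      show "continuous_on {a..b} (\<lambda>p. complex_of_real ((p - p1) powr (\<mu> - 1)) * w p)"
        using sub by (intro continuous_intros continuous_on_subset[OF w]) auto
      show "((\<lambda>p. complex_of_real ((p - p1) powr (\<mu> - 1)) * w p) has_vector_derivative
          complex_of_real ((p - p1) powr (\<mu> - 1)) * w' p + complex_of_real (\<beta>' p) * w p) (at p)"
        if "p \<in> {a<..<b}" for p
        using that sub(3) \<beta>[of p] by (intro has_vector_derivative_mult has_vector_derivative_of_real w') auto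
      show "norm (complex_of_real ((p - p1) powr (\<mu> - 1)) * w p) \<le> \<delta> powr (\<mu> - 1) * S"
        if "p \<in> {a..b}" for p
        unfolding norm_mult using that ab sub w_le[of p] amp_le[of p] by (intro mult_mono) auto
      show "norm (complex_of_real ((p - p1) powr (\<mu> - 1)) * w' p + complex_of_real (\<beta>' p) * w p)
          \<le> - \<beta>' p * S + \<delta> powr (\<mu> - 1) * norm (w' p)" if p: "p \<in> {a<..<b}" for p
      proof -
        have "norm (\<beta>' p) = - \<beta>' p"
          unfolding \<beta>'_def using \<open>\<mu> \<le> 1\<close> by (simp add: mult_nonpos_nonneg)
        moreover have "norm (\<beta>' p) * norm (w p) \<le> norm (\<beta>' p) * S"
          using p sub w_le[of p] by (intro mult_left_mono) auto
        moreover have "(p - p1) powr (\<mu> - 1) * norm (w' p) \<le> \<delta> powr (\<mu> - 1) * norm (w' p)"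
          using p ab amp_le[of p] by (intro mult_right_mono) auto
        ultimately show ?thesis
          by (intro order_trans[OF norm_triangle_ineq]) (simp add: norm_mult)
      qed
      show "(h has_real_derivative h1 p) (at p)" "(h1 has_real_derivative h2 p) (at p)" "0 \<le> h2 p"
        if "p \<in> {a..b}" for p
        using that sub(1) h[of p] h1[of p] h2[of p] \<open>0 < \<kappa>\<close> by auto
    qed (use \<open>0 < \<kappa>\<close> \<open>0 < \<delta>\<close> in auto)
    \<comment> \<open>Three copies of \<open>S\<close> come from the boundary terms and the
      variation of \<open>inverse h1\<close>, the fourth from the variation of the singular
      factor.\<close>
    also have "\<dots> \<le> (\<delta> powr (\<mu> - 1) * (4 * S + W)) / (\<kappa> * \<delta>)"
    proof (rule divide_right_mono)
      have "((a - p1) powr (\<mu> - 1) - (b - p1) powr (\<mu> - 1)) * S \<le> \<delta> powr (\<mu> - 1) * S"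
        using amp_le[of a] ab S0 by (intro mult_right_mono) (auto intro: order_trans[of _ "(a - p1) powr (\<mu> - 1)"])
      moreover have "\<delta> powr (\<mu> - 1) * V \<le> \<delta> powr (\<mu> - 1) * W"
        using V by (intro mult_left_mono) auto
      ultimately show "3 * (\<delta> powr (\<mu> - 1) * S)
          + (((a - p1) powr (\<mu> - 1) - (b - p1) powr (\<mu> - 1)) * S + \<delta> powr (\<mu> - 1) * V)
          \<le> \<delta> powr (\<mu> - 1) * (4 * S + W)" by (simp add: algebra_simps)
    qed (use \<open>0 < \<kappa>\<close> \<open>0 < \<delta>\<close> in auto)
    also have "\<dots> = K"
    proof -
      have "\<delta> powr (\<mu> - 2) = \<delta> powr (\<mu> - 1) / \<delta>"
        using \<open>0 < \<delta>\<close> powr_diff[of \<delta> "\<mu> - 1" 1] by simp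
      then show ?thesis unfolding K_def by (simp add: field_simps)
    qed
    finally show ?thesis unfolding F_def .
  qed

  have h1_cont: "continuous_on {p1..p2} h1"
    by (intro continuous_at_imp_continuous_on ballI DERIV_isCont[OF h1])
  have h1_growth: "\<kappa> * (q - p) \<le> h1 q - h1 p" if "p1 \<le> p" "p \<le> q" "q \<le> p2" for p q
  proof (cases "p = q")
    case False
    then have "\<exists>z>p. z < q \<and> h1 q - h1 p = (q - p) * h2 z"
      using that by (intro MVT2 h1) auto
    then obtain z where "p < z" "z < q" "h1 q - h1 p = (q - p) * h2 z" by blast
    then show ?thesis using h2[of z] that by (simp add: mult.commute mult_left_mono)
  qed simp
  \<comment> \<open>If \<open>h1\<close> keeps one sign, \<open>p0\<close> is the endpoint where its
    modulus is smallest; otherwise it is a zero of \<open>h1\<close>. The inequalities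
    \<open>p0 < p\<close> and \<open>p < p0\<close> are strict so that one of the two claims is
    vacuous when \<open>p0\<close> is an endpoint, where \<open>h1\<close> need not vanish.\<close>
  obtain p0 where p0: "p1 \<le> p0" "p0 \<le> p2"
    and right: "\<And>p. p0 < p \<Longrightarrow> p \<le> p2 \<Longrightarrow> \<kappa> * (p - p0) \<le> h1 p"
    and left: "\<And>p. p1 \<le> p \<Longrightarrow> p < p0 \<Longrightarrow> h1 p \<le> - (\<kappa> * (p0 - p))"
  proof -
    consider "0 \<le> h1 p1" | "h1 p2 \<le> 0" | "h1 p1 \<le> 0" "0 \<le> h1 p2" by linarith
    then show thesis
    proof cases
      case 1
      have "\<kappa> * (p - p1) \<le> h1 p" if "p1 < p" "p \<le> p2" for p
        using h1_growth[of p1 p] that 1 by auto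
      then show thesis using that[of p1] \<open>p1 < p2\<close> by auto
    next
      case 2
      have "h1 p \<le> - (\<kappa> * (p2 - p))" if "p1 \<le> p" "p < p2" for p
        using h1_growth[of p p2] that 2 by auto
      then show thesis using that[of p2] \<open>p1 < p2\<close> by auto
    next
      case 3
      then obtain z where z: "p1 \<le> z" "z \<le> p2" "h1 z = 0"
        using IVT'[of h1 p1 0 p2] h1_cont \<open>p1 < p2\<close> by auto
      have "\<kappa> * (p - z) \<le> h1 p" if "z < p" "p \<le> p2" for p
        using h1_growth[of z p] that z by auto
      moreover have "h1 p \<le> - (\<kappa> * (z - p))" if "p1 \<le> p" "p < z" for p
        using h1_growth[of p z] that z by auto
      ultimately show thesis using that[of z] z by blast
    qed
  qed

  \<comment> \<open>The right end of the window about \<open>p0\<close>, cut off at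
    \<open>p2\<close>. If it is cut off, the tail shrinks to a point.\<close>
  define e where "e = min (p0 + \<delta>) p2"
  have e: "p1 \<le> e" "e \<le> p2" "p0 \<le> e" "e \<le> p0 + \<delta>" unfolding e_def using p0 \<open>0 < \<delta>\<close> by auto
  have tail: "norm (integral {e..p2} F) \<le> K"
  proof (cases "p0 + \<delta> < p2")
    case True
    then have "e = p0 + \<delta>" unfolding e_def by simp
    moreover have "\<kappa> * \<delta> \<le> h1 p" if "p \<in> {p0 + \<delta>..p2}" for p
    proof -
      have "\<kappa> * \<delta> \<le> \<kappa> * (p - p0)" using that \<open>0 < \<kappa>\<close> by (intro mult_left_mono) auto
      also have "\<dots> \<le> h1 p" using that \<open>0 < \<delta>\<close> by (intro right) auto
      finally show ?thesis .
    qed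
    ultimately show ?thesis using p0 by (intro nonstationary) auto
  next
    case False
    then show ?thesis unfolding e_def using K0 by simp
  qed
  have split: "integral {p1..p2} F = integral {p1..e} F + integral {e..p2} F"
    using Henstock_Kurzweil_Integration.integral_combine[OF e(1,2) F_int] by simp
  show ?thesis
  proof (cases "p0 - \<delta> \<le> p1 + \<delta>")
    case True
    \<comment> \<open>The windows about \<open>p1\<close> and \<open>p0\<close> meet, so
      \<open>e\<close> is within \<open>3 * \<delta>\<close> of \<open>p1\<close> and one singular
      estimate covers both. The constant stays 3 because \<open>3 powr \<mu>\<close> is at most
      3.\<close>
    have "(e - p1) powr \<mu> \<le> (3 * \<delta>) powr \<mu>"
      using True e \<open>0 < \<mu>\<close> by (intro powr_mono2) auto
    also have "\<dots> \<le> 3 * \<delta> powr \<mu>"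
      using powr_mono[OF \<open>\<mu> \<le> 1\<close>, of 3] \<open>0 < \<delta>\<close> by (simp add: powr_mult mult_right_mono)
    finally have "S * ((e - p1) powr \<mu> / \<mu>) \<le> S * (3 * \<delta> powr \<mu> / \<mu>)"
      using S0 \<open>0 < \<mu>\<close> by (intro mult_left_mono divide_right_mono) auto
    then have "norm (integral {p1..e} F) \<le> 3 / \<mu> * S * \<delta> powr \<mu>"
      using singular[OF e(1,2)] by (simp add: algebra_simps)
    then show ?thesis
      unfolding split K_def[symmetric] using tail K0 by (intro order_trans[OF norm_triangle_ineq]) auto
  next
    case False
    \<comment> \<open>The windows are now separate: \<open>{p1..c}\<close> is singular,
      \<open>{d..e}\<close> surrounds \<open>p0\<close>, and \<open>h1\<close> is large on
      \<open>{c..d}\<close> and on the tail.\<close>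
    define c d where "c = p1 + \<delta>" and "d = p0 - \<delta>"
    have cd: "p1 \<le> c" "c \<le> d" "d \<le> e" "c \<le> e" "c \<le> p2" "d \<le> p2"
      unfolding c_def d_def using False e p0 \<open>0 < \<delta>\<close> by auto
    have "integral {p1..e} F = integral {p1..c} F + (integral {c..d} F + integral {d..e} F)"
      using Henstock_Kurzweil_Integration.integral_combine[of p1 c e F] Henstock_Kurzweil_Integration.integral_combine[of c d e F] cd e F_sub by simp
    then have "norm (integral {p1..p2} F) \<le> norm (integral {p1..c} F) + norm (integral {c..d} F)
        + norm (integral {d..e} F) + norm (integral {e..p2} F)"
      unfolding split by (smt (verit) norm_triangle_ineq)
    moreover have "norm (integral {p1..c} F) \<le> S * (\<delta> powr \<mu> / \<mu>)"
      using singular[of c] cd by (simp add: c_def)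
    moreover have "norm (integral {c..d} F) \<le> K"
    proof (rule nonstationary)
      have "h1 p \<le> - (\<kappa> * \<delta>)" if "p \<in> {c..d}" for p
      proof -
        have "h1 p \<le> - (\<kappa> * (p0 - p))"
          using that \<open>0 < \<delta>\<close> by (intro left) (auto simp: c_def d_def)
        also have "\<dots> \<le> - (\<kappa> * \<delta>)"
          using that \<open>0 < \<kappa>\<close> by (simp add: d_def)
        finally show ?thesis .
      qed
      then show "(\<forall>p\<in>{c..d}. \<kappa> * \<delta> \<le> h1 p) \<or> (\<forall>p\<in>{c..d}. h1 p \<le> - (\<kappa> * \<delta>))" by blast
    qed (use cd in \<open>auto simp: c_def\<close>)
    moreover have "norm (integral {d..e} F) \<le> 2 * S * (\<delta> powr \<mu> / \<mu>)"
    proof -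
      have "norm (integral {d..e} F) \<le> \<delta> powr (\<mu> - 1) * S * (e - d)"
        using cd e by (intro regular) (auto simp: c_def)
      also have "\<dots> \<le> \<delta> powr (\<mu> - 1) * S * (2 * \<delta>)"
        using e S0 by (intro mult_left_mono) (auto simp: d_def)
      also have "\<dots> = 2 * S * \<delta> powr \<mu>"
        using \<open>0 < \<delta>\<close> powr_mult_base[of \<delta> "\<mu> - 1"] by (simp add: algebra_simps)
      \<comment> \<open>Weakened by the factor \<open>1 / \<mu>\<close>, which is at least 1, to add
        up with the singular window to \<open>3 / \<mu>\<close>.\<close>
      also have "\<dots> \<le> 2 * S * (\<delta> powr \<mu> / \<mu>)"
        using S0 \<open>0 < \<mu>\<close> \<open>\<mu> \<le> 1\<close> by (intro mult_left_mono) (auto simp: le_divide_eq mult_left_le)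
      finally show ?thesis .
    qed
    moreover have "3 / \<mu> * S * \<delta> powr \<mu> = S * (\<delta> powr \<mu> / \<mu>) + 2 * S * (\<delta> powr \<mu> / \<mu>)"
      by (simp add: field_simps)
    ultimately show ?thesis unfolding K_def[symmetric] using tail by linarith
  qed
qed

section \<open>From almost-everywhere notions to pointwise ones\<close>

text \<open>The complement of the support is a union of possibly uncountably many open sets on which
  \<open>g\<close> vanishes almost everywhere. By Lindelof countably many of them suffice, so the
  exceptional null sets can be united.\<close>

lemma AE_eq_0_outside_ess_support: "AE p in lborel. p \<notin> ess_support g \<longrightarrow> g p = 0"
proof -
  define \<F> where "\<F> = {U. open U \<and> (AE y in lborel. y \<in> U \<longrightarrow> g y = 0)}"
  have "open U" if "U \<in> \<F>" for U using that by (auto simp: \<F>_def)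
  then obtain \<F>' where \<F>': "\<F>' \<subseteq> \<F>" "countable \<F>'" "\<Union>\<F>' = \<Union>\<F>"
    using Lindelof by metis
  have "AE y in lborel. \<forall>U\<in>\<F>'. y \<in> U \<longrightarrow> g y = 0"
    using \<F>' by (intro AE_ball_countable') (auto simp: \<F>_def)
  then show ?thesis
  proof (rule eventually_mono)
    fix y assume *: "\<forall>U\<in>\<F>'. y \<in> U \<longrightarrow> g y = 0"
    show "y \<notin> ess_support g \<longrightarrow> g y = 0"
    proof
      assume "y \<notin> ess_support g"
      then have "y \<in> \<Union>\<F>" unfolding ess_support_def \<F>_def by blast
      then show "g y = 0" using * \<F>'(3) by auto
    qed
  qed
qed

text \<open>If a continuous function exceeded its essential supremum at one point, it would do so on
  a nonempty open set, which is not null. Boundedness keeps the essential supremum finite;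
  \<open>real_of_ereal\<close> would turn infinity into 0.\<close>

lemma norm_le_Linf_norm:
  fixes w :: "real \<Rightarrow> complex"
  assumes "open I" and w: "continuous_on I w" and bdd: "bounded (w ` I)" and "p \<in> I"
  shows "norm (w p) \<le> real_of_ereal (Linf_norm I w)"
proof -
  let ?M = "restrict_space lborel I" and ?f = "\<lambda>x. ereal (norm (w x))"
  define L where "L = esssup ?M ?f"
  have I: "I \<in> sets lborel" using \<open>open I\<close> by simp
  have "(\<lambda>x. norm (w x)) \<in> borel_measurable (restrict_space borel I)"
    by (intro borel_measurable_continuous_on_restrict continuous_intros w)
  then have "(\<lambda>x. norm (w x)) \<in> borel_measurable ?M"
    by (simp cong: measurable_cong_sets sets_restrict_space_cong)
  then have meas: "?f \<in> borel_measurable ?M" by simp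
  obtain B where B: "\<And>x. x \<in> I \<Longrightarrow> norm (w x) \<le> B"
    using bdd unfolding bounded_iff by auto
  have "AE x in ?M. ?f x \<le> ereal B"
    using B by (intro AE_I2) (auto simp: space_restrict_space)
  then have L_le: "L \<le> ereal B" unfolding L_def using meas by (intro esssup_I)
  have "AE x in lborel. x \<in> I \<longrightarrow> ?f x \<le> L"
    using esssup_AE[of ?f ?M] I unfolding L_def by (simp add: AE_restrict_space_iff)
  have "ereal (norm (w p)) \<le> L"
  proof (rule ccontr)
    assume "\<not> ereal (norm (w p)) \<le> L"
    then have "L < ereal (norm (w p))" by simp
    from ereal_dense2[OF this] obtain c where c: "L < ereal c" "c < norm (w p)" by auto
    define U where "U = {x \<in> I. c < norm (w x)}"
    have "open ((\<lambda>x. norm (w x)) -` {c<..} \<inter> I)"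
      using continuous_on_open_vimage[OF \<open>open I\<close>] continuous_on_norm[OF w] open_greaterThan by blast
    moreover have "(\<lambda>x. norm (w x)) -` {c<..} \<inter> I = U" by (auto simp: U_def)
    ultimately have "open U" by simp
    have "AE x in lborel. x \<in> - U"
      using \<open>AE x in lborel. x \<in> I \<longrightarrow> ?f x \<le> L\<close>
      by (rule eventually_mono) (use c(1) in \<open>auto simp: U_def dest: le_less_trans\<close>)
    then have "AE x in lebesgue. x \<in> - U" by (rule AE_completion)
    then have "p \<in> - U" using \<open>open U\<close> by (intro mem_closed_if_AE_lebesgue) auto
    then show False using \<open>p \<in> I\<close> c(2) by (simp add: U_def)
  qed
  with L_le show ?thesis unfolding Linf_norm_def L_def[symmetric] by (cases L) auto
qed

text \<open>\<open>LEAST\<close> can be evaluated only once a minimum is known to exist; compactness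
  provides it.\<close>

lemma min_second_deriv_attained:
  assumes "p1 \<le> p2" and "continuous_on {p1..p2} (deriv (deriv f))"
  shows "min_second_deriv f p1 p2 \<in> deriv (deriv f) ` {p1..p2}"
    and "\<And>p. p \<in> {p1..p2} \<Longrightarrow> min_second_deriv f p1 p2 \<le> deriv (deriv f) p"
proof -
  obtain z where z: "z \<in> {p1..p2}" "\<forall>p\<in>{p1..p2}. deriv (deriv f) z \<le> deriv (deriv f) p"
    using continuous_attains_inf[OF compact_Icc _ assms(2)] \<open>p1 \<le> p2\<close> by auto
  then have "min_second_deriv f p1 p2 = deriv (deriv f) z"
    unfolding min_second_deriv_def by (intro Least_equality) auto
  with z show "min_second_deriv f p1 p2 \<in> deriv (deriv f) ` {p1..p2}"
    and "\<And>p. p \<in> {p1..p2} \<Longrightarrow> min_second_deriv f p1 p2 \<le> deriv (deriv f) p"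
    by auto
qed

lemma smooth_real_derivs:
  assumes "smooth_real f"
  shows "(f has_real_derivative deriv f p) (at p)"
    and "(deriv f has_real_derivative deriv (deriv f) p) (at p)"
    and "isCont (deriv (deriv f)) p"
proof -
  have *: "(deriv ^^ n) f field_differentiable at p" for n
    using assms unfolding smooth_real_def by blast
  show "(f has_real_derivative deriv f p) (at p)"
    using *[of 0] by (simp add: DERIV_deriv_iff_field_differentiable)
  show "(deriv f has_real_derivative deriv (deriv f) p) (at p)"
    using *[of 1] by (simp add: DERIV_deriv_iff_field_differentiable)
  show "isCont (deriv (deriv f)) p"
    using *[of 2] by (simp add: field_differentiable_imp_continuous_at numeral_2_eq_2)
qed

section \<open>The solution as an oscillatory integral over the support\<close>

lemma set_integrable_mult_phase:
  fixes g :: "real \<Rightarrow> complex" and h :: "real \<Rightarrow> real"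
  assumes "set_integrable lborel A g" and "h \<in> borel_measurable borel"
  shows "set_integrable lborel A (\<lambda>p. g p * exp (- \<i> * complex_of_real (h p)))"
proof -
  have [measurable]: "(\<lambda>p. indicator A p *\<^sub>R g p) \<in> borel_measurable borel"
    using assms(1) unfolding set_integrable_def by (auto dest: borel_measurable_integrable)
  note assms(2)[measurable]
  have [measurable]: "(\<lambda>p. (indicator A p *\<^sub>R g p) * exp (- \<i> * complex_of_real (h p))) \<in> borel_measurable lborel"
    by measurable
  have "integrable lborel (\<lambda>p. (indicator A p *\<^sub>R g p) * exp (- \<i> * complex_of_real (h p)))"
    by (rule Bochner_Integration.integrable_bound[OF assms(1)[unfolded set_integrable_def]])
       (auto simp: norm_mult norm_exp_eq_Re simp del: mult_scaleR_left)
  then show ?thesis unfolding set_integrable_def by simp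
qed

lemma solution_eq_set_integral:
  assumes g: "\<And>a b. set_integrable lborel {a..b} g"
    and supp: "ess_support g \<subseteq> A" and A: "A \<in> sets borel"
    and f: "f \<in> borel_measurable borel"
  shows "solution f g t x = 1 / (2 * pi) *
    (LINT p:A|lborel. g p * exp (- \<i> * complex_of_real (t * f p - x * p)))"
proof -
  \<comment> \<open>Only local integrability of \<open>g\<close> is given, so its measurability on
    the whole line is obtained from the pointwise limit of its truncations.\<close>
  have lim: "(\<lambda>n. indicator {- real n..real n} p *\<^sub>R g p) \<longlonglongrightarrow> g p" for p
  proof (rule tendsto_eventually)
    obtain N where N: "\<bar>p\<bar> \<le> real N" using real_arch_simple by blast
    show "\<forall>\<^sub>F n in sequentially. indicator {- real n..real n} p *\<^sub>R g p = g p"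
      using eventually_ge_at_top[of N] by eventually_elim (use N in \<open>auto simp: indicator_def\<close>)
  qed
  have [measurable]: "g \<in> borel_measurable borel"
    using g by (intro borel_measurable_LIMSEQ_metric[OF _ lim])
       (auto simp: set_integrable_def dest: borel_measurable_integrable)
  note f[measurable] A[measurable]
  have "(LINT p|lborel. g p * exp (- \<i> * complex_of_real (t * f p) + \<i> * complex_of_real (x * p)))
      = (LINT p:A|lborel. g p * exp (- \<i> * complex_of_real (t * f p - x * p)))"
    unfolding set_lebesgue_integral_def
  proof (rule integral_cong_AE)
    show "AE p in lborel. g p * exp (- \<i> * complex_of_real (t * f p) + \<i> * complex_of_real (x * p))
        = indicator A p *\<^sub>R (g p * exp (- \<i> * complex_of_real (t * f p - x * p)))"
      using AE_eq_0_outside_ess_support[of g]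
      by eventually_elim (use supp in \<open>auto simp: indicator_def algebra_simps\<close>)
  qed measurable
  then show ?thesis unfolding solution_def by simp
qed

text \<open>A pointwise bound yields a bound on \<open>Linf_norm\<close> only for measurable
  functions, since the essential supremum is infinite otherwise. Measurability in \<open>x\<close>
  is that of a parameter integral with jointly measurable integrand.\<close>

lemma solution_measurable:
  assumes g: "\<And>a b. set_integrable lborel {a..b} g" and supp: "ess_support g \<subseteq> {a..b}"
    and [measurable]: "f \<in> borel_measurable borel"
  shows "solution f g t \<in> borel_measurable borel"
proof -
  have [measurable]: "(\<lambda>p. indicator {a..b} p *\<^sub>R g p) \<in> borel_measurable borel"
    using g unfolding set_integrable_def by (auto dest: borel_measurable_integrable)
  have "solution f g t = (\<lambda>x. 1 / (2 * pi) * (LINT p|lborel.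
      (indicator {a..b} p *\<^sub>R g p) * exp (- \<i> * complex_of_real (t * f p - x * p))))"
    using solution_eq_set_integral[OF g supp] by (auto simp: set_lebesgue_integral_def)
  moreover have "\<dots> \<in> borel_measurable borel"
    by measurable
  ultimately show ?thesis by simp
qed

lemma norm_solution_le:
  assumes "smooth_real f"
    and f'': "\<And>p. deriv (deriv f) p > 0"
    and "0 < \<mu>" and "\<mu> \<le> 1"
    and "p1 < p2"
    and g: "\<And>a b. set_integrable lborel {a..b} g"
    and supp: "ess_support g \<subseteq> {p1..p2}"
    and g_eq: "\<And>p. p \<in> {p1<..p2} \<Longrightarrow> g p = complex_of_real ((p - p1) powr (\<mu> - 1)) * w p"
    and w: "continuous_on {p1..p2} w"
    and w': "\<And>p. p \<in> {p1<..<p2} \<Longrightarrow> w differentiable at p"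
    and w'_int: "set_integrable lborel {p1<..<p2} (vderiv w)"
    and "0 < t"
  shows "norm (solution f g t x) \<le> const_c f \<mu> w p1 p2 * t powr (- \<mu> / 2)"
proof -
  \<comment> \<open>The choice of \<open>\<delta>\<close> makes \<open>\<delta> powr \<mu>\<close>
    and \<open>\<delta> powr (\<mu> - 2) / t\<close> both equal to
    \<open>t powr (- \<mu> / 2)\<close>, so the windows and the nonstationary parts decay at the
    same rate.\<close>
  define S W m \<delta> where "S = real_of_ereal (Linf_norm {p1<..<p2} w)"
    and "W = L1_norm {p1<..<p2} (vderiv w)" and "m = min_second_deriv f p1 p2"
    and "\<delta> = t powr (- 1 / 2)"
  define h where "h = (\<lambda>p. t * f p - x * p)"
  define F where "F = (\<lambda>p. complex_of_real ((p - p1) powr (\<mu> - 1)) * w p * exp (- \<i> * complex_of_real (h p)))"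
  note f_derivs = smooth_real_derivs[OF \<open>smooth_real f\<close>]
  have f''_cont: "continuous_on {p1..p2} (deriv (deriv f))"
    by (intro continuous_at_imp_continuous_on ballI f_derivs(3))
  have f_meas [measurable]: "f \<in> borel_measurable borel"
    by (intro borel_measurable_continuous_onI continuous_at_imp_continuous_on ballI DERIV_isCont[OF f_derivs(1)])
  have m: "0 < m" "\<And>p. p \<in> {p1..p2} \<Longrightarrow> m \<le> deriv (deriv f) p"
    unfolding m_def
    using min_second_deriv_attained[OF less_imp_le[OF \<open>p1 < p2\<close>] f''_cont] f'' by auto
  have "bounded (w ` {p1<..<p2})"
    using compact_imp_bounded[OF compact_continuous_image[OF w]] by (auto elim: bounded_subset)
  then have "norm (w p) \<le> S" if "p \<in> {p1<..<p2}" for p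
    unfolding S_def using that by (intro norm_le_Linf_norm continuous_on_subset[OF w]) auto
  \<comment> \<open>The sup norm is taken over the open interval; continuity carries the bound to
    the endpoints.\<close>
  then have w_le: "norm (w p) \<le> S" if "p \<in> {p1..p2}" for p
    using continuous_le_on_closure[of "{p1<..<p2}" "\<lambda>p. norm (w p)" p S] that w \<open>p1 < p2\<close>
    by (auto intro: continuous_intros)
  have W: "((\<lambda>p. norm (vderiv w p)) has_integral W) {p1..p2}"
    unfolding has_integral_Icc_iff_Ioo W_def L1_norm_def
    using set_borel_integral_eq_integral[OF set_integrable_norm[OF w'_int]] by (simp add: has_integral_iff)
  have ge: "set_integrable lborel {p1..p2} (\<lambda>p. g p * exp (- \<i> * complex_of_real (h p)))"
    by (intro set_integrable_mult_phase g) (simp add: h_def)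
  \<comment> \<open>The point \<open>p1\<close> is left out: \<open>F p1\<close> is 0 because
    \<open>0 powr a = 0\<close>, even for exponent 0, while \<open>g p1\<close> is not prescribed. A
    single point does not change the integral.\<close>
  have spike: "g p * exp (- \<i> * complex_of_real (h p)) = F p" if "p \<in> {p1..p2} - {p1}" for p
    using g_eq[of p] that by (simp add: F_def)
  have F_int: "F integrable_on {p1..p2}"
    using set_borel_integral_eq_integral(1)[OF ge] spike
    by (subst integrable_spike_finite_eq[of "{p1}"]) auto
  have "(LINT p:{p1..p2}|lborel. g p * exp (- \<i> * complex_of_real (h p))) = integral {p1..p2} F"
    unfolding set_borel_integral_eq_integral(2)[OF ge]
    using spike by (intro integral_spike[of "{p1}"]) auto
  then have "solution f g t x = 1 / (2 * pi) * integral {p1..p2} F"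
    using solution_eq_set_integral[OF g supp _ f_meas] by (simp add: h_def)
  then have "norm (solution f g t x) = 1 / (2 * pi) * norm (integral {p1..p2} F)"
    by (simp add: norm_mult norm_divide)
  also have "\<dots> \<le> 1 / (2 * pi) *
      (3 / \<mu> * S * \<delta> powr \<mu> + 2 * ((4 * S + W) / (t * m) * \<delta> powr (\<mu> - 2)))"
  proof (intro mult_left_mono)
    show "norm (integral {p1..p2} F)
        \<le> 3 / \<mu> * S * \<delta> powr \<mu> + 2 * ((4 * S + W) / (t * m) * \<delta> powr (\<mu> - 2))"
      unfolding F_def
    proof (rule singular_oscillatory_integral_bound)
      show "(h has_real_derivative (t * deriv f p - x)) (at p)" for p
        unfolding h_def by (auto intro!: derivative_eq_intros f_derivs(1))
      show "((\<lambda>p. t * deriv f p - x) has_real_derivative t * deriv (deriv f) p) (at p)" for p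
        by (auto intro!: derivative_eq_intros f_derivs(2))
      show "(w has_vector_derivative vderiv w p) (at p)" if "p \<in> {p1<..<p2}" for p
        using w'[OF that] by (simp add: vderiv_def vector_derivative_works)
      show "t * m \<le> t * deriv (deriv f) p" if "p \<in> {p1..p2}" for p
        using m(2)[OF that] \<open>0 < t\<close> by simp
    qed (use \<open>0 < t\<close> m(1) w w_le W F_int \<open>0 < \<mu>\<close> \<open>\<mu> \<le> 1\<close> \<open>p1 < p2\<close> in \<open>auto simp: \<delta>_def F_def\<close>)
  qed simp
  also have "\<delta> powr \<mu> = t powr (- \<mu> / 2)"
    unfolding \<delta>_def by (simp add: powr_powr)
  \<comment> \<open>The extra factor \<open>t\<close> cancels the one in \<open>t * m\<close>, the
    lower bound for the second derivative of the phase.\<close>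
  also have "\<delta> powr (\<mu> - 2) = t * t powr (- \<mu> / 2)"
  proof -
    have "- 1 / 2 * (\<mu> - 2) = 1 + - \<mu> / 2" by (simp add: field_simps)
    then show ?thesis
      unfolding \<delta>_def powr_powr powr_mult_base[OF less_imp_le[OF \<open>0 < t\<close>]] by simp
  qed
  also have "1 / (2 * pi) * (3 / \<mu> * S * t powr (- \<mu> / 2) + 2 * ((4 * S + W) / (t * m) * (t * t powr (- \<mu> / 2))))
      = const_c f \<mu> w p1 p2 * t powr (- \<mu> / 2)"
    unfolding const_c_def Let_def S_def[symmetric] W_def[symmetric] m_def[symmetric]
    using \<open>0 < t\<close> m(1) \<open>0 < \<mu>\<close> by (simp add: field_simps)
  finally show ?thesis .
qed

section \<open>The decay estimates in the sup norm\<close>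

theorem corollary2p4:
  fixes f :: "real \<Rightarrow> real"
    and \<mu> p1 p2 q1 q2 :: real
    and u0 :: "(real \<Rightarrow> complex) \<Rightarrow> complex"
    and Fu0 w :: "real \<Rightarrow> complex"
    and u :: "real \<Rightarrow> real \<Rightarrow> complex"
  assumes "smooth_real f"
    and "polynomially_growing_derivs f"
    and "\<And>p. deriv (deriv f) p > 0"
    and "0 < \<mu>" and "\<mu> \<le> 1"
    and "p1 < p2"
    and "tempered_distribution u0"
    and "distr_is_function (fourier_distr u0) Fu0"
    and "ess_support Fu0 = {p1..p2}"
    and "\<And>p. p \<in> {p1<..p2} \<Longrightarrow> Fu0 p = complex_of_real ((p - p1) powr (\<mu> - 1)) * w p"
    and "continuous_on {p1..p2} w"
    and "\<And>p. p \<in> {p1<..<p2} \<Longrightarrow> w differentiable at p"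
    and "set_integrable lborel {p1<..<p2} (vderiv w)"
    and "\<mu> \<noteq> 1 \<Longrightarrow> w p1 \<noteq> 0"
    and "\<And>t x. t > 0 \<Longrightarrow> u t x = solution f Fu0 t x"
    and "q1 < p1" and "p2 < q2"
  shows "min_second_deriv f p1 p2 > 0 \<and> deriv f p1 - deriv f q1 > 0 \<and> deriv f q2 - deriv f p2 > 0 \<and>
    (\<forall>t>0. Linf_norm UNIV (u t) \<le>
       ereal (const_c f \<mu> w p1 p2 * t powr (- \<mu> / 2) + const_cc f \<mu> w p1 p2 q1 q2 * t powr (- \<mu>))) \<and>
    (\<forall>t\<ge>1. Linf_norm UNIV (u t) \<le>
       ereal ((const_c f \<mu> w p1 p2 + const_cc f \<mu> w p1 p2 q1 q2) * t powr (- \<mu> / 2)))"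
proof (intro conjI allI impI)
  let ?c = "const_c f \<mu> w p1 p2" and ?cc = "const_cc f \<mu> w p1 p2 q1 q2"
  note f_derivs = smooth_real_derivs[OF assms(1)]
  have f''_cont: "continuous_on {p1..p2} (deriv (deriv f))"
    by (intro continuous_at_imp_continuous_on ballI f_derivs(3))
  show "min_second_deriv f p1 p2 > 0"
    using min_second_deriv_attained(1)[OF less_imp_le[OF \<open>p1 < p2\<close>] f''_cont] assms(3) by auto
  have f'_mono: "deriv f a < deriv f b" if "a < b" for a b
    using that by (rule DERIV_pos_imp_increasing) (use f_derivs(2) assms(3) in blast)
  show m1: "deriv f p1 - deriv f q1 > 0" and m2: "deriv f q2 - deriv f p2 > 0"
    using f'_mono \<open>q1 < p1\<close> \<open>p2 < q2\<close> by auto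
  have g: "set_integrable lborel {a..b} Fu0" for a b
    using assms(8) unfolding distr_is_function_def by blast
  have supp: "ess_support Fu0 \<subseteq> {p1..p2}" using assms(9) by simp
  have f_meas: "f \<in> borel_measurable borel"
    by (intro borel_measurable_continuous_onI continuous_at_imp_continuous_on ballI DERIV_isCont[OF f_derivs(1)])
  have u_le: "Linf_norm UNIV (u t) \<le> ereal (?c * t powr (- \<mu> / 2))" if "t > 0" for t
  proof -
    have u: "u t = solution f Fu0 t" using assms(15) \<open>t > 0\<close> by auto
    have "norm (u t x) \<le> ?c * t powr (- \<mu> / 2)" for x
      unfolding u using assms(1,3-6) g supp assms(10-13) \<open>t > 0\<close> by (rule norm_solution_le)
    moreover have "u t \<in> borel_measurable borel"
      unfolding u by (rule solution_measurable[OF g supp f_meas])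
    ultimately show ?thesis
      unfolding Linf_norm_def by (intro esssup_I borel_measurable_ereal measurable_restrict_space1) auto
  qed
  \<comment> \<open>The signs of the constants need the real value of the sup norm to be
    nonnegative; comparison with the norm of \<open>w\<close> at the midpoint gives this.\<close>
  have "bounded (w ` {p1<..<p2})"
    using compact_imp_bounded[OF compact_continuous_image[OF assms(11)]] by (auto elim: bounded_subset)
  moreover have "(p1 + p2) / 2 \<in> {p1<..<p2}" using \<open>p1 < p2\<close> by simp
  ultimately have "norm (w ((p1 + p2) / 2)) \<le> real_of_ereal (Linf_norm {p1<..<p2} w)"
    by (intro norm_le_Linf_norm continuous_on_subset[OF assms(11)]) auto
  then have "0 \<le> real_of_ereal (Linf_norm {p1<..<p2} w)"
    using norm_ge_zero order_trans by blast
  moreover have "0 \<le> L1_norm {p1<..<p2} (vderiv w)"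
    unfolding L1_norm_def set_lebesgue_integral_def by (intro integral_nonneg_AE) auto
  ultimately have cc: "0 \<le> ?cc"
    unfolding const_cc_def Let_def using m1 m2 \<open>0 < \<mu>\<close> by simp
  fix t :: real
  show "Linf_norm UNIV (u t) \<le> ereal (?c * t powr (- \<mu> / 2) + ?cc * t powr (- \<mu>))" if "t > 0"
    using cc by (intro order_trans[OF u_le[OF that]]) simp
  show "Linf_norm UNIV (u t) \<le> ereal ((?c + ?cc) * t powr (- \<mu> / 2))" if "t \<ge> 1"
    using cc that by (intro order_trans[OF u_le]) (auto simp: distrib_right)
qed

end
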